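(* Let $K:[0,\infty)\to(0,1]$ be continuous, non-increasing, normalized by $K(0)=1$, and satisfy $K(t)<1$ for every $t>0$. Suppose that the excess diversity $E_K$ is additive in adjacent gaps for every three-point set, that is, for all $a,b>0$ the similarity matrix of $\{0,a,a+b\}$ is nonsingular (so that all terms below are defined) and $$E_K(\{0,a,a+b\})=E_K(\{0,a\})+E_K(\{0,b\}).$$ Then $K$ belongs to the exponential family. More precisely, $$K(t)=e^{-\beta t}\qquad(t\geq 0),$$ where the parameter is uniquely fixed by the one-step value, $\beta=-\log K(1)>0$.
   Context: For a function $K:[0,\infty)\to(0,1]$ and a finite ordered set $S=\{x_1<\cdots<x_k\}\subset\mathbb{R}$, define the similarity matrix $Z_K(S)\in\mathbb{R}^{k\times k}$ by $(Z_K(S))_{ij}=K(|x_i-x_j|)$. Whenever $Z_K(S)$ is nonsingular, put $D_K(S)=\mathbf{1}^\top Z_K(S)^{-1}\mathbf{1}$, where $\mathbf{1}$ is the all-ones column vector in $\mathbb{R}^k$, and define the excess diversity $E_K(S)=D_K(S)-1$. *)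

theory Defs
  imports Complex_Main "Jordan_Normal_Form.Gauss_Jordan_Elimination"
begin

text \<open>
  A finite set of reals is enumerated increasingly by \<^const>\<open>sorted_list_of_set\<close>; the points
  are indexed from 0. Infinite sets are not meant as arguments.
\<close>

definition similarity_matrix :: "(real \<Rightarrow> real) \<Rightarrow> real set \<Rightarrow> real mat" where
  "similarity_matrix K S =
     mat (card S) (card S)
       (\<lambda>(i, j). K \<bar>sorted_list_of_set S ! i - sorted_list_of_set S ! j\<bar>)"

text \<open>
  Only meaningful if the similarity matrix is nonsingular: \<^const>\<open>mat_inverse\<close> returns
  \<^const>\<open>None\<close> on a singular matrix, and the value is then unspecified.
\<close>

definition diversity :: "(real \<Rightarrow> real) \<Rightarrow> real set \<Rightarrow> real" where
  "diversity K S =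
     (let ones = vec (card S) (\<lambda>_. 1)
      in ones \<bullet> (the (mat_inverse (similarity_matrix K S)) *\<^sub>v ones))"

definition excess_diversity :: "(real \<Rightarrow> real) \<Rightarrow> real set \<Rightarrow> real" where
  "excess_diversity K S = diversity K S - 1"

end

theory Submission
  imports Defs
begin

text \<open>
  Write x, y, z for the values of K at a, b, a + b. Additivity of the excess diversity is a
  quadratic equation for z with roots x y and x y + (1 - x^2) (1 - y^2) / (1 - x y). The second
  root exceeds min x y, whereas z \<le> min x y because K is non-increasing. Hence
  K (a + b) = K a * K b, and a monotone solution of this Cauchy equation is exponential.
\<close>

text \<open>Since \<open>mat_inverse\<close> yields a right inverse \<open>C\<close>, the vector
  \<open>C\<close> times all-ones solves Z w = 1, and its entries sum to the diversity. Later
  arguments need only this linear system, not the entries of \<open>mat_inverse\<close>.\<close>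

lemma invertible_mat_diversity:
  assumes "invertible_mat (similarity_matrix K S)"
  obtains w where "w \<in> carrier_vec (card S)"
    "similarity_matrix K S *\<^sub>v w = vec (card S) (\<lambda>_. 1)"
    "diversity K S = (\<Sum>i<card S. w $ i)"
proof -
  define n where "n = card S"
  define Z where "Z = similarity_matrix K S"
  define ones :: "real vec" where "ones = vec n (\<lambda>_. 1)"
  have Z: "Z \<in> carrier_mat n n"
    by (simp add: Z_def similarity_matrix_def n_def)
  have ones: "ones \<in> carrier_vec n"
    by (simp add: ones_def)
  obtain B where B: "inverts_mat Z B" "inverts_mat B Z"
    using assms unfolding invertible_mat_def Z_def by auto
  have "dim_row B = n" "dim_col B = n"
    using B Z unfolding inverts_mat_def
    by (metis carrier_matD index_mult_mat(3) index_one_mat(3))+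
  then have Bc: "B \<in> carrier_mat n n" by auto
  have "Z * B = 1\<^sub>m n" "B * Z = 1\<^sub>m n"
    using B Z Bc unfolding inverts_mat_def by auto
  \<comment> \<open>The specification of \<open>mat_inverse\<close> rules out \<open>None\<close>
    for units of the matrix ring, so invertibility is recast in that form.\<close>
  then have "Z \<in> Units (ring_mat TYPE(real) n ())"
    using Z Bc unfolding Units_def ring_mat_def by auto
  with mat_inverse(1)[OF Z, where b = "()"] obtain C where C: "mat_inverse Z = Some C"
    by (cases "mat_inverse Z") auto
  have ZC: "Z * C = 1\<^sub>m n" and Cc: "C \<in> carrier_mat n n"
    using mat_inverse(2)[OF Z C] by auto
  have "Z *\<^sub>v (C *\<^sub>v ones) = ones"
    using assoc_mult_mat_vec[OF Z Cc ones] ZC ones by simp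
  moreover have "diversity K S = (\<Sum>i<n. (C *\<^sub>v ones) $ i)"
    using C Cc unfolding diversity_def Let_def
    by (simp add: Z_def[symmetric] n_def[symmetric] ones_def[symmetric])
       (simp add: scalar_prod_def ones_def lessThan_atLeast0)
  moreover have "C *\<^sub>v ones \<in> carrier_vec n"
    using Cc ones by simp
  ultimately show thesis
    using that[of "C *\<^sub>v ones"] unfolding n_def Z_def ones_def by blast
qed

lemma similarity_matrix_two:
  assumes "(a::real) > 0"
  shows "similarity_matrix K {0, a} = mat 2 2 (\<lambda>(i, j). if i = j then K 0 else K a)"
proof -
  have "sorted_list_of_set {0, a} = [0, a]" "card {0, a} = 2"
    using assms by auto
  then show ?thesis
    unfolding similarity_matrix_def
    by (intro eq_matI) (use assms in \<open>auto simp: less_2_cases_iff\<close>)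
qed

text \<open>The two rows of Z w = 1 add up to (1 + x) (w0 + w1) = 2, so the diversity is 2 / (1 +
  x).\<close>

lemma excess_diversity_two:
  assumes "a > 0" "K 0 = 1" "0 < K a" "K a < 1"
  shows "excess_diversity K {0, a} = (1 - K a) / (1 + K a)"
proof -
  define Z where "Z = similarity_matrix K {0, a}"
  define x where "x = K a"
  \<comment> \<open>The reciprocal of the determinant; \<open>B\<close> is the adjugate scaled by
    it. It witnesses nonsingularity, which is not a hypothesis for two points.\<close>
  define c where "c = 1 / (1 - x\<^sup>2)"
  define B where "B = mat 2 2 (\<lambda>(i, j). if i = j then c else - c * x)"
  have Z: "Z = mat 2 2 (\<lambda>(i, j). if i = j then 1 else x)"
    unfolding Z_def x_def similarity_matrix_two[OF assms(1)] using assms(2) by (intro eq_matI) auto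
  have "x\<^sup>2 < 1" using assms unfolding x_def by (simp add: power_less_one_iff)
  then have c: "c * (1 - x\<^sup>2) = 1" by (simp add: c_def)
  have "Z * B = 1\<^sub>m 2" "B * Z = 1\<^sub>m 2"
    unfolding Z B_def using c
    by (intro eq_matI; auto simp: scalar_prod_def less_2_cases_iff numeral_2_eq_2 algebra_simps)+
  then have "invertible_mat Z"
    unfolding invertible_mat_def inverts_mat_def by (auto simp: Z B_def intro!: exI[of _ B])
  then obtain w where w: "w \<in> carrier_vec (card {0, a})"
    "Z *\<^sub>v w = vec (card {0, a}) (\<lambda>_. 1)"
    "diversity K {0, a} = (\<Sum>i<card {0, a}. w $ i)"
    using invertible_mat_diversity unfolding Z_def by metis
  have card: "card {0, a} = 2" using assms(1) by simp
  have "(Z *\<^sub>v w) $ 0 = 1" "(Z *\<^sub>v w) $ 1 = 1"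
    using w(2) card by simp_all
  then have "w $ 0 + x * w $ 1 = 1" "x * w $ 0 + w $ 1 = 1"
    using w(1) card by (simp_all add: Z scalar_prod_def numeral_2_eq_2)
  then have "(1 + x) * diversity K {0, a} = 2"
    using w(3) card by (simp add: numeral_2_eq_2 algebra_simps)
  moreover have "1 + x \<noteq> 0" using assms x_def by simp
  ultimately have "diversity K {0, a} = 2 / (1 + x)"
    by (simp add: field_simps)
  then show ?thesis
    using \<open>1 + x \<noteq> 0\<close> unfolding excess_diversity_def x_def[symmetric] by (simp add: field_simps)
qed

text \<open>
  Stated as a polynomial identity: the determinant times the diversity is the sum of the
  cofactors.
\<close>

lemma diversity_three:
  assumes "a > 0" "b > 0" "K 0 = 1"
    and inv: "invertible_mat (similarity_matrix K {0, a, a + b})"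
  defines "x \<equiv> K a" and "y \<equiv> K b" and "z \<equiv> K (a + b)"
  shows "(1 + 2 * x * y * z - x\<^sup>2 - y\<^sup>2 - z\<^sup>2) * diversity K {0, a, a + b} =
    (1 - x) * (1 + x) + (1 - y) * (1 + y) + (1 - z) * (1 + z)
    - 2 * (x - y * z) - 2 * (y - x * z) - 2 * (z - x * y)"
proof -
  define Z where "Z = similarity_matrix K {0, a, a + b}"
  have c: "card {0, a, a + b} = 3" using assms(1,2) by simp
  have l: "sorted_list_of_set {0, a, a + b} = [0, a, a + b]"
    using assms(1,2) by auto
  have Z: "Z = mat 3 3 (\<lambda>(i, j). K \<bar>[0, a, a + b] ! i - [0, a, a + b] ! j\<bar>)"
    unfolding Z_def similarity_matrix_def c l ..
  obtain w where w: "w \<in> carrier_vec 3" "Z *\<^sub>v w = vec 3 (\<lambda>_. 1)"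
    "diversity K {0, a, a + b} = (\<Sum>i<3. w $ i)"
    using invertible_mat_diversity[OF inv] unfolding Z_def c by metis
  have "(Z *\<^sub>v w) $ 0 = 1" "(Z *\<^sub>v w) $ 1 = 1" "(Z *\<^sub>v w) $ 2 = 1"
    using w(2) by simp_all
  then have e: "w $ 0 + x * w $ 1 + z * w $ 2 = 1" "x * w $ 0 + w $ 1 + y * w $ 2 = 1"
    "z * w $ 0 + y * w $ 1 + w $ 2 = 1"
    using w(1) assms(1-3)
    by (simp_all add: Z scalar_prod_def numeral_3_eq_3 numeral_2_eq_2 x_def y_def z_def)
  have "diversity K {0, a, a + b} = w $ 0 + w $ 1 + w $ 2"
    using w(3) by (simp add: numeral_3_eq_3 numeral_2_eq_2)
  \<comment> \<open>The left factor is det Z, and the three multipliers on the right are the row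
    sums of the adjugate (Cramer's rule). By \<open>e\<close> each bracket they multiply equals
    1.\<close>
  then have "(1 + 2 * x * y * z - x\<^sup>2 - y\<^sup>2 - z\<^sup>2) * diversity K {0, a, a + b} =
    (1 - y\<^sup>2 - (x - y * z) - (z - x * y)) * (w $ 0 + x * w $ 1 + z * w $ 2)
    + (1 - z\<^sup>2 - (x - y * z) - (y - x * z)) * (x * w $ 0 + w $ 1 + y * w $ 2)
    + (1 - x\<^sup>2 - (z - x * y) - (y - x * z)) * (z * w $ 0 + y * w $ 1 + w $ 2)"
    by (simp add: algebra_simps power2_eq_square)
  then show ?thesis unfolding e by (simp add: algebra_simps power2_eq_square)
qed

text \<open>Eliminating \<open>D\<close> between the determinant identity and the additivity
  equation leaves a quadratic in z; the bounds on z select its root x y.\<close>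

lemma additive_imp_mult:
  fixes x y z D :: real
  assumes x: "0 < x" "x < 1" and y: "0 < y" "y < 1" and z: "z \<le> x" "z \<le> y"
    and D: "(1 + 2 * x * y * z - x\<^sup>2 - y\<^sup>2 - z\<^sup>2) * D =
      (1 - x) * (1 + x) + (1 - y) * (1 + y) + (1 - z) * (1 + z)
      - 2 * (x - y * z) - 2 * (y - x * z) - 2 * (z - x * y)"
    and add: "D - 1 = (1 - x) / (1 + x) + (1 - y) / (1 + y)"
  shows "z = x * y"
proof -
  \<comment> \<open>With t the smaller and s the larger of x and y, this says that t lies below the
    unwanted root. The difference of the two sides factors as (1 - s) (1 + s - t - t^2), positive
    because t \<le> s and t^2 < 1.\<close>
  have larger_root: "(1 - s * t) * t < 1 + s * t - s\<^sup>2 - t\<^sup>2"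
    if "0 < t" "t \<le> s" "s < 1" for s t :: real
  proof -
    have "t\<^sup>2 < 1" using that by (simp add: power_less_one_iff)
    then have "0 < (1 - s) * (1 + s - t - t\<^sup>2)" using that by (intro mult_pos_pos) auto
    also have "\<dots> = 1 + s * t - s\<^sup>2 - t\<^sup>2 - (1 - s * t) * t"
      by (simp add: algebra_simps power2_eq_square)
    finally show ?thesis by simp
  qed
  have xy: "0 \<le> 1 - x * y" using mult_strict_mono[of x 1 y 1] x y by simp
  have "(1 - x * y) * z < 1 + x * y - x\<^sup>2 - y\<^sup>2"
  proof (cases "y \<le> x")
    case True
    then show ?thesis
      using larger_root[of y x] x y mult_left_mono[OF z(2) xy] by linarith
  next
    case False
    then show ?thesis
      using larger_root[of x y] x y mult_left_mono[OF z(1) xy]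
      by (simp add: mult.commute)
  qed
  moreover have "(z - x * y) * ((1 - x * y) * z - (1 + x * y - x\<^sup>2 - y\<^sup>2)) = 0"
  proof -
    have "(D - 1) * ((1 + x) * (1 + y)) = (1 - x) * (1 + y) + (1 - y) * (1 + x)"
      unfolding add using x y by (simp add: add_frac_eq)
    \<comment> \<open>The right side is a combination of the hypothesis \<open>D\<close> and of
      \<open>add\<close> cleared of denominators, arranged so that \<open>D\<close> cancels; both
      differences vanish.\<close>
    moreover have "2 * ((z - x * y) * ((1 - x * y) * z - (1 + x * y - x\<^sup>2 - y\<^sup>2))) =
      (1 + x) * (1 + y) * ((1 - x) * (1 + x) + (1 - y) * (1 + y) + (1 - z) * (1 + z)
        - 2 * (x - y * z) - 2 * (y - x * z) - 2 * (z - x * y)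
        - (1 + 2 * x * y * z - x\<^sup>2 - y\<^sup>2 - z\<^sup>2) * D)
      + (1 + 2 * x * y * z - x\<^sup>2 - y\<^sup>2 - z\<^sup>2)
        * ((D - 1) * ((1 + x) * (1 + y)) - ((1 - x) * (1 + y) + (1 - y) * (1 + x)))"
      by (simp add: algebra_simps power2_eq_square)
    ultimately show ?thesis unfolding D by simp
  qed
  ultimately show ?thesis by simp
qed

text \<open>Comparing n t with its neighbouring integers bounds n times the error \<bar>g t - t * g
  1\<bar> by \<open>g 1\<close>, uniformly in n; by the Archimedean property the error is 0.\<close>

lemma monotone_additive_imp_linear:
  fixes g :: "real \<Rightarrow> real"
  assumes add: "\<And>s t. s \<ge> 0 \<Longrightarrow> t \<ge> 0 \<Longrightarrow> g (s + t) = g s + g t"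
    and mono: "mono_on {0..} g" and "t \<ge> 0"
  shows "g t = t * g 1"
proof -
  have g0: "g 0 = 0" using add[of 0 0] by simp
  have mult: "g (real n * s) = real n * g s" if "s \<ge> 0" for n s
    using that by (induction n) (simp_all add: g0 add distrib_right)
  have bound: "real n * \<bar>g t - t * g 1\<bar> \<le> g 1" for n
  proof -
    \<comment> \<open>With this m, both n * g t (by monotonicity) and n * t * g 1 (as g 1 \<ge> 0)
      lie between m * g 1 and (m + 1) * g 1, an interval of length g 1.\<close>
    define m where "m = nat \<lfloor>real n * t\<rfloor>"
    have m: "real m \<le> real n * t" "real n * t \<le> real (Suc m)"
      using \<open>t \<ge> 0\<close> unfolding m_def by (simp_all, linarith+)
    have "g (real m * 1) \<le> g (real n * t)" "g (real n * t) \<le> g (real (Suc m) * 1)"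
      using m \<open>t \<ge> 0\<close> by (auto intro!: mono_onD[OF mono])
    then have "real m * g 1 \<le> real n * g t" "real n * g t \<le> real (Suc m) * g 1"
      using mult \<open>t \<ge> 0\<close> by (metis zero_le_one)+
    moreover have "0 \<le> g 1" using mono_onD[OF mono, of 0 1] g0 by simp
    then have "real m * g 1 \<le> real n * t * g 1" "real n * t * g 1 \<le> real (Suc m) * g 1"
      using m by (simp_all add: mult_right_mono)
    ultimately have "\<bar>real n * g t - real n * t * g 1\<bar> \<le> g 1"
      by (simp add: algebra_simps abs_le_iff)
    moreover have "real n * \<bar>g t - t * g 1\<bar> = \<bar>real n * g t - real n * t * g 1\<bar>"
      by (simp add: abs_mult[of "real n", simplified, symmetric] algebra_simps)
    ultimately show ?thesis by simp
  qed
  show ?thesis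
  proof (rule ccontr)
    assume "g t \<noteq> t * g 1"
    then obtain n where "g 1 < real n * \<bar>g t - t * g 1\<bar>"
      using reals_Archimedean3[of "\<bar>g t - t * g 1\<bar>"] by auto
    with bound[of n] show False by simp
  qed
qed

theorem proposition1:
  fixes K :: "real \<Rightarrow> real"
  assumes range: "\<And>t. t \<ge> 0 \<Longrightarrow> 0 < K t \<and> K t \<le> 1"
    and cont: "continuous_on {0..} K"
    and noninc: "antimono_on {0..} K"
    and normalized: "K 0 = 1"
    and less_one: "\<And>t. t > 0 \<Longrightarrow> K t < 1"
    and nonsingular: "\<And>a b. a > 0 \<Longrightarrow> b > 0 \<Longrightarrow> invertible_mat (similarity_matrix K {0, a, a + b})"
    and additive: "\<And>a b. a > 0 \<Longrightarrow> b > 0 \<Longrightarrow>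
      excess_diversity K {0, a, a + b} = excess_diversity K {0, a} + excess_diversity K {0, b}"
  shows "- ln (K 1) > 0
    \<and> (\<forall>t\<ge>0. K t = exp (- (- ln (K 1)) * t))
    \<and> (\<forall>\<beta>::real. (\<forall>t\<ge>0. K t = exp (- \<beta> * t)) \<longrightarrow> \<beta> = - ln (K 1))"
proof -
  have mult_pos: "K (a + b) = K a * K b" if "a > 0" "b > 0" for a b
  proof (rule additive_imp_mult)
    show "0 < K a" "K a < 1" "0 < K b" "K b < 1"
      using range[of a] range[of b] less_one that by auto
    then show "diversity K {0, a, a + b} - 1 = (1 - K a) / (1 + K a) + (1 - K b) / (1 + K b)"
      using additive[OF that] excess_diversity_two that normalized
      by (simp add: excess_diversity_def[of K "{0, a, a + b}"])
    show "K (a + b) \<le> K a" "K (a + b) \<le> K b"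
      using that by (auto intro!: monotone_onD[OF noninc])
    show "(1 + 2 * K a * K b * K (a + b) - (K a)\<^sup>2 - (K b)\<^sup>2 - (K (a + b))\<^sup>2)
        * diversity K {0, a, a + b} =
      (1 - K a) * (1 + K a) + (1 - K b) * (1 + K b) + (1 - K (a + b)) * (1 + K (a + b))
      - 2 * (K a - K b * K (a + b)) - 2 * (K b - K a * K (a + b)) - 2 * (K (a + b) - K a * K b)"
      using diversity_three[OF that normalized nonsingular[OF that]] .
  qed
  \<comment> \<open>The logarithm makes the equation additive, and the sign makes \<open>g\<close>
    non-decreasing.\<close>
  define g where "g t = - ln (K t)" for t
  have "g (s + t) = g s + g t" if "s \<ge> 0" "t \<ge> 0" for s t
  \<comment> \<open>\<open>mult_pos\<close> covers only positive gaps, where the three points are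
    distinct; a zero gap is settled by K 0 = 1.\<close>
  proof (cases "s = 0 \<or> t = 0")
    case True
    then show ?thesis using normalized by (auto simp: g_def)
  next
    case False
    then show ?thesis
      using mult_pos[of s t] range[of s] range[of t] that by (simp add: g_def ln_mult)
  qed
  moreover have "mono_on {0..} g"
  proof (rule mono_onI)
    fix r s :: real
    assume rs: "r \<in> {0..}" "s \<in> {0..}" "r \<le> s"
    then have "K s \<le> K r" by (rule monotone_onD[OF noninc])
    then show "g r \<le> g s" using range[of r] range[of s] rs by (simp add: g_def)
  qed
  ultimately have lin: "g t = t * g 1" if "t \<ge> 0" for t
    using monotone_additive_imp_linear that by blast
  have "- ln (K 1) > 0"
    using range[of 1] less_one[of 1] by (simp add: ln_less_zero)
  moreover have "K t = exp (- (- ln (K 1)) * t)" if "t \<ge> 0" for t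
  proof -
    have "K t = exp (- g t)" using range[OF that] by (simp add: g_def)
    also have "\<dots> = exp (- (- ln (K 1)) * t)"
      using lin[OF that] by (simp add: g_def mult.commute)
    finally show ?thesis .
  qed
  \<comment> \<open>Evaluation at t = 1 determines the parameter.\<close>
  moreover have "\<beta> = - ln (K 1)" if "\<forall>t\<ge>0. K t = exp (- \<beta> * t)" for \<beta> :: real
    using that by simp
  ultimately show ?thesis by blast
qed

end
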